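(* Let $T$ be a linear functional and let $\mathcal{F}_1$ and $\mathcal{F}_2$ be parameter spaces with $\mathcal{F}_1\cap\mathcal{F}_2\neq\varnothing$ and $\omega(\varepsilon,\mathcal{F}_1)\le\omega(\varepsilon,\mathcal{F}_2)$ for all sufficiently small $0<\varepsilon\le\varepsilon_0$. Suppose that $\hat T$ is an estimator of $Tf$ based on the white noise data (at noise level $1/\sqrt n$) satisfying $$\sup_{f\in\mathcal{F}_1}E_f(\hat T-Tf)^2\le c_*^2\,\omega^2\!\left(\tfrac{1}{\sqrt n},\mathcal{F}_1\right)$$ for some constant $c_*>0$. Let $$\gamma_n=\max\left\{e,\ \frac{\omega_+(1/\sqrt n,\mathcal{F}_1,\mathcal{F}_2)}{c_*\,\omega(1/\sqrt n,\mathcal{F}_1)}\right\}.$$ Then there exists some fixed constant $c>0$ such that, for all sufficiently large $n$, $$\sup_{f\in\mathcal{F}_2}E_f(\hat T-Tf)^2\ \ge\ c\left\{\omega_+^2\!\left(\sqrt{\tfrac{\ln\gamma_n}{n}},\mathcal{F}_1,\mathcal{F}_2\right)+\omega^2\!\left(\tfrac{1}{\sqrt n},\mathcal{F}_2\right)\right\}.$$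
   Context: White noise model: one observes $dY(t)=f(t)\,dt+\frac{1}{\sqrt n}\,dW(t)$, $-\frac12\le t\le\frac12$, where $W$ is a standard Brownian motion and $f\in L^2[-\frac12,\frac12]$ is unknown. $E_f$ is expectation when $f$ is the true function. An estimator is a measurable function of the data $Y$ (it may depend on $n$). Parameter spaces are subsets of $L^2[-\frac12,\frac12]$ and $T$ is a linear functional (not necessarily $L^2$-continuous) defined on the functions considered. Moduli of continuity: $\omega(\varepsilon,\mathcal{F})=\sup\{|Tg-Tf|:\|g-f\|_2\le\varepsilon,\ f\in\mathcal{F},\ g\in\mathcal{F}\}$; the between-class modulus is $\omega_+(\varepsilon,\mathcal{F}_1,\mathcal{F}_2)=\sup\{|Tg-Tf|:\|g-f\|_2\le\varepsilon,\ f\in\mathcal{F}_1,\ g\in\mathcal{F}_2\}$. *)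

theory Defs
  imports "HOL-Probability.Probability"
begin

abbreviation obs_interval :: "real set"
  where "obs_interval \<equiv> {-1/2..1/2}"

(* Functions on the interval are represented by their extensional versions.  They are not
   identified when they agree almost everywhere: typical functionals T (such as point evaluation)
   are not defined on equivalence classes. *)
definition L2_functions :: "(real \<Rightarrow> real) set"
  where "L2_functions =
    {f \<in> extensional obs_interval. f \<in> borel_measurable (lebesgue_on obs_interval) \<and>
       integrable (lebesgue_on obs_interval) (\<lambda>t. (f t)\<^sup>2)}"

definition L2_dist :: "(real \<Rightarrow> real) \<Rightarrow> (real \<Rightarrow> real) \<Rightarrow> real"
  where "L2_dist g f = sqrt (\<integral>t. (g t - f t)\<^sup>2 \<partial>lebesgue_on obs_interval)"

definition lin_comb :: "real \<Rightarrow> (real \<Rightarrow> real) \<Rightarrow> real \<Rightarrow> (real \<Rightarrow> real) \<Rightarrow> real \<Rightarrow> real"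
  where "lin_comb a f b g = (\<lambda>t\<in>obs_interval. a * f t + b * g t)"

(* The domain D is a linear subspace of the square integrable functions; no continuity of T. *)
definition linear_functional_on :: "(real \<Rightarrow> real) set \<Rightarrow> ((real \<Rightarrow> real) \<Rightarrow> real) \<Rightarrow> bool"
  where "linear_functional_on D T \<longleftrightarrow>
    D \<subseteq> L2_functions \<and> D \<noteq> {} \<and>
    (\<forall>f\<in>D. \<forall>g\<in>D. \<forall>a b. lin_comb a f b g \<in> D \<and> T (lin_comb a f b g) = a * T f + b * T g)"

(* Moduli are suprema in [0,\<infinity>]; the radius is also allowed to be infinite, see log_radius. *)
definition between_modulus ::
  "((real \<Rightarrow> real) \<Rightarrow> real) \<Rightarrow> ennreal \<Rightarrow> (real \<Rightarrow> real) set \<Rightarrow> (real \<Rightarrow> real) set \<Rightarrow> ennreal"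
  where "between_modulus T \<epsilon> F1 F2 =
    Sup {ennreal \<bar>T g - T f\<bar> | f g. ennreal (L2_dist g f) \<le> \<epsilon> \<and> f \<in> F1 \<and> g \<in> F2}"

definition modulus :: "((real \<Rightarrow> real) \<Rightarrow> real) \<Rightarrow> ennreal \<Rightarrow> (real \<Rightarrow> real) set \<Rightarrow> ennreal"
  where "modulus T \<epsilon> F =
    Sup {ennreal \<bar>T g - T f\<bar> | f g. ennreal (L2_dist g f) \<le> \<epsilon> \<and> f \<in> F \<and> g \<in> F}"

(* Brownian motion on the observation interval, started in 0 at its left end point. *)
definition standard_brownian_motion :: "'a measure \<Rightarrow> (real \<Rightarrow> 'a \<Rightarrow> real) \<Rightarrow> bool"
  where "standard_brownian_motion M W \<longleftrightarrow>
    prob_space M \<and>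
    (\<forall>t\<in>obs_interval. W t \<in> borel_measurable M) \<and>
    (\<forall>x\<in>space M. W (-1/2) x = 0) \<and>
    (\<forall>x\<in>space M. continuous_on obs_interval (\<lambda>t. W t x)) \<and>
    (\<forall>s\<in>obs_interval. \<forall>t\<in>obs_interval. s < t \<longrightarrow>
       distributed M lborel (\<lambda>x. W t x - W s x) (normal_density 0 (sqrt (t - s)))) \<and>
    (\<forall>(k::nat) t. mono_on {..k} t \<and> t ` {..k} \<subseteq> obs_interval \<longrightarrow>
       prob_space.indep_vars M (\<lambda>_. borel) (\<lambda>i x. W (t (Suc i)) x - W (t i) x) {..<k})"

(* dY(t) = f(t) dt + dW(t) / sqrt n in integrated form with Y(-1/2) = 0. *)
definition observation ::
  "(real \<Rightarrow> 'a \<Rightarrow> real) \<Rightarrow> nat \<Rightarrow> (real \<Rightarrow> real) \<Rightarrow> 'a \<Rightarrow> real \<Rightarrow> real"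
  where "observation W n f x =
    (\<lambda>t\<in>obs_interval. set_lebesgue_integral lebesgue {-1/2..t} f + W t x / sqrt (real n))"

(* C[-1/2,1/2] with the sigma-algebra generated by the evaluations, which is its Borel
   sigma-algebra for the supremum norm. *)
definition path_space :: "(real \<Rightarrow> real) measure"
  where "path_space =
    restrict_space (\<Pi>\<^sub>M t\<in>obs_interval. borel) {y. continuous_on obs_interval y}"

(* Mean squared error E_f (That - T f)^2 at noise level 1 / sqrt n. *)
definition mse ::
  "'a measure \<Rightarrow> (real \<Rightarrow> 'a \<Rightarrow> real) \<Rightarrow> nat \<Rightarrow> ((real \<Rightarrow> real) \<Rightarrow> real) \<Rightarrow>
   ((real \<Rightarrow> real) \<Rightarrow> real) \<Rightarrow> (real \<Rightarrow> real) \<Rightarrow> ennreal"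
  where "mse M W n T That f =
    (\<integral>\<^sup>+x. ennreal ((That (observation W n f x) - T f)\<^sup>2) \<partial>M)"

definition noise_level :: "nat \<Rightarrow> ennreal"
  where "noise_level n = ennreal (1 / sqrt (real n))"

(* Degenerate quotients follow ennreal division: a / 0 = \<infinity> for a > 0, while 0 / 0 = 0 and
   a / \<infinity> = 0, in which cases the maximum is e. *)
definition gamma_n ::
  "((real \<Rightarrow> real) \<Rightarrow> real) \<Rightarrow> (real \<Rightarrow> real) set \<Rightarrow> (real \<Rightarrow> real) set \<Rightarrow> real \<Rightarrow> nat \<Rightarrow> ennreal"
  where "gamma_n T F1 F2 cs n =
    max (ennreal (exp 1))
      (between_modulus T (noise_level n) F1 F2 / (ennreal cs * modulus T (noise_level n) F1))"

(* sqrt (ln \<gamma> / n), with ln \<infinity> = \<infinity>. *)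
definition log_radius :: "ennreal \<Rightarrow> nat \<Rightarrow> ennreal"
  where "log_radius \<gamma> n =
    (if \<gamma> = \<top> then \<top> else ennreal (sqrt (ln (enn2real \<gamma>) / real n)))"

end

theory Submission
  imports Defs "HOL-Real_Asymp.Real_Asymp"
begin

text \<open>
  Two signals \<open>f\<close> and \<open>g\<close> satisfy \<open>P\<^sub>g(A)\<^sup>2 \<le> exp (n \<parallel>g - f\<parallel>\<^sup>2) P\<^sub>f(A)\<close> for every event \<open>A\<close> of the
  path space: on cylinder sets the increments are independent Gaussians, where this is the
  Cauchy-Schwarz inequality for the likelihood ratio, and every event is approximated by cylinder
  sets under both laws. Taking for \<open>A\<close> the event that the estimator is at least \<open>3\<Delta>/4\<close> away from
  \<open>T f\<close>, where \<open>\<Delta> = \<bar>T g - T f\<bar>\<close>, a risk at \<open>f\<close> which is small compared with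
  \<open>\<Delta>\<^sup>2 exp (-n \<parallel>g - f\<parallel>\<^sup>2)\<close> forces the risk at \<open>g\<close> to be at least \<open>\<Delta>\<^sup>2/144\<close>. Pairs within \<open>F2\<close> at the
  noise level bound the modulus of \<open>F2\<close>, hence that of \<open>F1\<close>, hence the risk over \<open>F1\<close>, by the
  maximal risk over \<open>F2\<close>; pairs in \<open>F1 \<times> F2\<close> within the logarithmic radius then bound the
  between-class modulus.
\<close>

subsection \<open>Approximation by algebras and Gaussian shifts\<close>

text \<open>The sets that admit such a \<open>B\<close> for every \<epsilon> contain the algebra and
  are closed under complements and countable unions. A single \<open>B\<close> has to serve both
  measures, because an inequality relating two laws is to be carried over from the algebra.\<close>

lemma approx_by_algebra:
  assumes "algebra \<Omega> \<A>" and sets1: "sets M1 = sigma_sets \<Omega> \<A>" and sets2: "sets M2 = sigma_sets \<Omega> \<A>"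
    and fin1: "finite_measure M1" and fin2: "finite_measure M2"
    and E: "E \<in> sigma_sets \<Omega> \<A>" and "\<epsilon> > 0"
  shows "\<exists>B\<in>\<A>. measure M1 (sym_diff E B) < \<epsilon> \<and> measure M2 (sym_diff E B) < \<epsilon>"
proof -
  interpret algebra \<Omega> \<A> by fact
  interpret M1: finite_measure M1 by fact
  interpret M2: finite_measure M2 by fact
  have sp: "space M1 = \<Omega>" "space M2 = \<Omega>"
    using sets_eq_imp_space_eq[of _ "sigma \<Omega> \<A>"] sets1 sets2 space_closed by simp_all
  have A_in: "B \<in> sets M1" "B \<in> sets M2" if "B \<in> \<A>" for B
    using that sets1 sets2 by auto
  show ?thesis using E \<open>\<epsilon> > 0\<close>
  proof (induction arbitrary: \<epsilon> rule: sigma_sets.induct)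
    case (Basic a)
    then show ?case by (intro bexI[of _ a]) auto
  next
    case Empty
    then show ?case by (intro bexI[of _ "{}"]) auto
  next
    case (Compl a)
    then obtain B where B: "B \<in> \<A>" "measure M1 (sym_diff a B) < \<epsilon>" "measure M2 (sym_diff a B) < \<epsilon>"
      by blast
    have "a \<subseteq> \<Omega>" "B \<subseteq> \<Omega>"
      using Compl.hyps sigma_sets_into_sp space_closed B by blast+
    then have "sym_diff (\<Omega> - a) (\<Omega> - B) = sym_diff a B" by blast
    with B show ?case by (intro bexI[of _ "\<Omega> - B"]) auto
  next
    case (Union a)
    have a_in: "a i \<in> sets M1" "a i \<in> sets M2" for i
      using Union.hyps sets1 sets2 by auto
    let ?U = "\<lambda>k. \<Union>i<k. a i"
    have UU: "(\<Union>k. ?U k) = (\<Union>i. a i)" by blast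
    have ev: "\<forall>\<^sub>F k in sequentially. measure N (\<Union>i. a i) - measure N (?U k) < \<epsilon> / 2"
      if "finite_measure N" "\<And>i. a i \<in> sets N" for N
    proof -
      interpret finite_measure N by fact
      have "(\<lambda>k. measure N (?U k)) \<longlonglongrightarrow> measure N (\<Union>k. ?U k)"
        using that by (intro finite_Lim_measure_incseq) (auto simp: incseq_def dest: order_less_le_trans)
      then have "\<forall>\<^sub>F k in sequentially. measure N (?U k) > measure N (\<Union>i. a i) - \<epsilon> / 2"
        unfolding UU using \<open>\<epsilon> > 0\<close> by (intro order_tendstoD) auto
      then show ?thesis by eventually_elim simp
    qed
    \<comment> \<open>One cut-off for both measures: the discarded tail costs half of \<epsilon>,
      and the other half is shared among the first \<open>k\<close> sets. \<open>Suc k\<close> in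
      the shares avoids a division by zero.\<close>
    obtain k where k: "measure M1 (\<Union>i. a i) - measure M1 (?U k) < \<epsilon> / 2"
        "measure M2 (\<Union>i. a i) - measure M2 (?U k) < \<epsilon> / 2"
      using eventually_happens'[OF _ eventually_conj[OF ev[OF fin1] ev[OF fin2]]] a_in by auto
    have "\<forall>i. \<exists>B\<in>\<A>. measure M1 (sym_diff (a i) B) < \<epsilon> / (2 * Suc k)
        \<and> measure M2 (sym_diff (a i) B) < \<epsilon> / (2 * Suc k)"
      using Union.IH \<open>\<epsilon> > 0\<close> by simp
    then obtain B where B: "\<And>i. B i \<in> \<A>" "\<And>i. measure M1 (sym_diff (a i) (B i)) < \<epsilon> / (2 * Suc k)"
        "\<And>i. measure M2 (sym_diff (a i) (B i)) < \<epsilon> / (2 * Suc k)"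
      by metis
    have est: "measure N (sym_diff (\<Union>i. a i) (\<Union>i<k. B i)) < \<epsilon>"
      if "finite_measure N" and [measurable]: "\<And>i. a i \<in> sets N" "\<And>i. B i \<in> sets N"
        and d: "\<And>i. measure N (sym_diff (a i) (B i)) < \<epsilon> / (2 * Suc k)"
        and kk: "measure N (\<Union>i. a i) - measure N (?U k) < \<epsilon> / 2" for N
    proof -
      interpret finite_measure N by fact
      have "measure N (sym_diff (\<Union>i. a i) (\<Union>i<k. B i))
          \<le> measure N (((\<Union>i. a i) - ?U k) \<union> (\<Union>i<k. sym_diff (a i) (B i)))"
        by (intro finite_measure_mono) auto
      also have "\<dots> \<le> measure N ((\<Union>i. a i) - ?U k) + measure N (\<Union>i<k. sym_diff (a i) (B i))"
        by (intro measure_Un_le) auto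
      also have "measure N ((\<Union>i. a i) - ?U k) = measure N (\<Union>i. a i) - measure N (?U k)"
        by (intro finite_measure_Diff) auto
      also have "measure N (\<Union>i<k. sym_diff (a i) (B i)) \<le> (\<Sum>i<k. measure N (sym_diff (a i) (B i)))"
        by (intro finite_measure_subadditive_finite) auto
      also have "\<dots> \<le> (\<Sum>i<k. \<epsilon> / (2 * Suc k))"
        using d by (intro sum_mono less_imp_le)
      also have "\<dots> \<le> \<epsilon> / 2" using \<open>\<epsilon> > 0\<close> by (simp add: field_simps)
      finally show ?thesis using kk by simp
    qed
    have "(\<Union>i<k. B i) \<in> \<A>" using B by (intro finite_UN) auto
    then show ?case
      using est[OF fin1 a_in(1) A_in(1)[OF B(1)] B(2) k(1)] est[OF fin2 a_in(2) A_in(2)[OF B(1)] B(3) k(2)]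
      by blast
  qed
qed

section \<open>Likelihood ratios of shifted Gaussians\<close>

text \<open>The exponential is the likelihood ratio of two normal laws with the same
  variance.\<close>

lemma normal_density_shift:
  assumes "\<sigma> > 0"
  shows "exp (((x - a)\<^sup>2 - (x - b)\<^sup>2) / (2 * \<sigma>\<^sup>2)) * normal_density a \<sigma> x = normal_density b \<sigma> x"
  using assms by (simp add: normal_density_def exp_add[symmetric] field_simps)

text \<open>Completing the square turns the squared likelihood ratio times the density into a
  constant times the normal density centred at \<open>2 * b - a\<close>, the reflection of
  \<open>a\<close> in \<open>b\<close>. The latter integrates to 1, so the constant is the second
  moment.\<close>

lemma nn_integral_normal_shift_square:
  assumes "\<sigma> > 0"
  shows "(\<integral>\<^sup>+x. ennreal ((exp (((x - a)\<^sup>2 - (x - b)\<^sup>2) / (2 * \<sigma>\<^sup>2)))\<^sup>2)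
      \<partial>density lborel (normal_density a \<sigma>)) = ennreal (exp ((b - a)\<^sup>2 / \<sigma>\<^sup>2))"
proof -
  have eq: "normal_density a \<sigma> x * (exp (((x - a)\<^sup>2 - (x - b)\<^sup>2) / (2 * \<sigma>\<^sup>2)))\<^sup>2
      = exp ((b - a)\<^sup>2 / \<sigma>\<^sup>2) * normal_density (2 * b - a) \<sigma> x" for x
  proof -
    have e: "- ((x - a)\<^sup>2 / (2 * \<sigma>\<^sup>2)) + ((x - a)\<^sup>2 - (x - b)\<^sup>2) / \<sigma>\<^sup>2
        = (b - a)\<^sup>2 / \<sigma>\<^sup>2 + - ((x - (2 * b - a))\<^sup>2 / (2 * \<sigma>\<^sup>2))"
      using assms by (simp add: field_simps) (simp add: power2_eq_square algebra_simps)
    have "(exp (((x - a)\<^sup>2 - (x - b)\<^sup>2) / (2 * \<sigma>\<^sup>2)))\<^sup>2 = exp (((x - a)\<^sup>2 - (x - b)\<^sup>2) / \<sigma>\<^sup>2)"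
      by (simp only: exp_double[symmetric] mult_divide_mult_cancel_left times_divide_eq_right)
    then show ?thesis
      using arg_cong[OF e, of exp, unfolded exp_add] by (simp add: normal_density_def mult.commute mult.left_commute)
  qed
  have "(\<integral>\<^sup>+x. ennreal ((exp (((x - a)\<^sup>2 - (x - b)\<^sup>2) / (2 * \<sigma>\<^sup>2)))\<^sup>2)
      \<partial>density lborel (normal_density a \<sigma>))
      = (\<integral>\<^sup>+x. ennreal (exp ((b - a)\<^sup>2 / \<sigma>\<^sup>2)) * ennreal (normal_density (2 * b - a) \<sigma> x) \<partial>lborel)"
    by (subst nn_integral_density) (auto simp: ennreal_mult[symmetric] eq)
  also have "\<dots> = ennreal (exp ((b - a)\<^sup>2 / \<sigma>\<^sup>2)) * (\<integral>\<^sup>+x. ennreal (normal_density (2 * b - a) \<sigma> x) \<partial>lborel)"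
    by (intro nn_integral_cmult) auto
  also have "(\<integral>\<^sup>+x. ennreal (normal_density (2 * b - a) \<sigma> x) \<partial>lborel) = 1"
    using prob_space.emeasure_space_1[OF prob_space_normal_density[OF assms, of "2 * b - a"]]
    by (simp add: emeasure_density)
  finally show ?thesis by simp
qed

text \<open>The product \<open>R\<close> of the coordinate likelihood ratios is the density of
  \<open>Q b\<close> with respect to \<open>Q a\<close>. Cauchy-Schwarz for \<open>R\<close> times
  the indicator of \<open>B\<close> leaves the second moment of \<open>R\<close>, which factorises
  over the coordinates.\<close>

lemma product_normal_shift:
  fixes a b \<sigma> :: "'i \<Rightarrow> real"
  assumes K: "finite K" and \<sigma>: "\<And>i. \<sigma> i > 0"
    and B[measurable]: "B \<in> sets (PiM K (\<lambda>_. borel))"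
  defines "Q \<equiv> \<lambda>m. PiM K (\<lambda>i. density lborel (normal_density (m i) (\<sigma> i)))"
  shows "(emeasure (Q b) B)\<^sup>2 \<le> ennreal (exp (\<Sum>i\<in>K. (b i - a i)\<^sup>2 / (\<sigma> i)\<^sup>2)) * emeasure (Q a) B"
proof -
  let ?N = "\<lambda>m i. density lborel (normal_density (m i) (\<sigma> i))"
  have prob: "prob_space (?N m i)" for m i
    using \<sigma> by (rule prob_space_normal_density)
  then have sf: "product_sigma_finite (?N m)" for m
    unfolding product_sigma_finite_def by (simp add: prob_space_imp_sigma_finite)
  interpret a: product_sigma_finite "?N a" by (rule sf)
  interpret b: product_sigma_finite "?N b" by (rule sf)
  define r where "r i x = exp (((x - a i)\<^sup>2 - (x - b i)\<^sup>2) / (2 * (\<sigma> i)\<^sup>2))" for i x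
  have [measurable]: "r i \<in> borel_measurable borel" for i unfolding r_def by measurable
  define R where "R x = (\<Prod>i\<in>K. ennreal (r i (x i)))" for x
  have setsQ[measurable_cong]: "sets (Q m) = sets (PiM K (\<lambda>_. borel))" for m
    unfolding Q_def by (intro sets_PiM_cong) auto
  have R[measurable]: "R \<in> borel_measurable (PiM K (\<lambda>_. borel))"
    unfolding R_def by measurable
  \<comment> \<open>A product measure is determined by its values on rectangles, where the integral
    of \<open>R\<close> splits into one-dimensional ones.\<close>
  have "density (Q a) R = Q b"
    unfolding Q_def
  proof (rule b.PiM_eqI[OF K])
    show "sets (density (Pi\<^sub>M K (?N a)) R) = sets (Pi\<^sub>M K (?N b))"
      using setsQ unfolding Q_def by simp
    fix A assume A: "\<And>i. i \<in> K \<Longrightarrow> A i \<in> sets (?N b i)"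
    then have A'[measurable]: "\<And>i. i \<in> K \<Longrightarrow> A i \<in> sets borel" by auto
    have PA: "Pi\<^sub>E K A \<in> sets (Q a)" unfolding setsQ using A' K by auto
    have ind: "indicator (Pi\<^sub>E K A) x = (\<Prod>i\<in>K. indicator (A i) (x i) :: ennreal)" if "x \<in> space (Q a)" for x
      using that K by (auto simp: indicator_def PiE_iff Q_def space_PiM prod_zero_iff intro!: prod.neutral)
    have "emeasure (density (Q a) R) (Pi\<^sub>E K A) = (\<integral>\<^sup>+x. R x * indicator (Pi\<^sub>E K A) x \<partial>Q a)"
      using PA by (subst emeasure_density) auto
    also have "\<dots> = (\<integral>\<^sup>+x. (\<Prod>i\<in>K. ennreal (r i (x i)) * indicator (A i) (x i)) \<partial>Q a)"
      by (intro nn_integral_cong) (simp add: R_def ind prod.distrib)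
    also have "\<dots> = (\<Prod>i\<in>K. \<integral>\<^sup>+x. ennreal (r i x) * indicator (A i) x \<partial>?N a i)"
      unfolding Q_def using K by (subst a.product_nn_integral_prod) auto
    also have "\<dots> = (\<Prod>i\<in>K. emeasure (?N b i) (A i))"
    proof (intro prod.cong refl)
      fix i assume i: "i \<in> K"
      have "(\<integral>\<^sup>+x. ennreal (r i x) * indicator (A i) x \<partial>?N a i)
          = (\<integral>\<^sup>+x. ennreal (normal_density (b i) (\<sigma> i) x) * indicator (A i) x \<partial>lborel)"
        using i normal_density_shift[OF \<sigma>[of i], of _ "a i" "b i"]
        by (subst nn_integral_density) (auto simp: r_def mult.assoc[symmetric] ennreal_mult[symmetric] mult.commute[of "normal_density _ _ _"])
      then show "(\<integral>\<^sup>+x. ennreal (r i x) * indicator (A i) x \<partial>?N a i) = emeasure (?N b i) (A i)"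
        using i by (simp add: emeasure_density)
    qed
    finally show "emeasure (density (Pi\<^sub>M K (?N a)) R) (Pi\<^sub>E K A) = (\<Prod>i\<in>K. emeasure (?N b i) (A i))"
      unfolding Q_def .
  qed
  then have "emeasure (Q b) B = (\<integral>\<^sup>+x. R x * indicator B x \<partial>Q a)"
    by (metis emeasure_density R B setsQ measurable_cong_sets)
  then have "(emeasure (Q b) B)\<^sup>2 \<le> (\<integral>\<^sup>+x. (R x)\<^sup>2 \<partial>Q a) * (\<integral>\<^sup>+x. (indicator B x)\<^sup>2 \<partial>Q a)"
    by (simp add: Cauchy_Schwarz_nn_integral)
  also have "(\<integral>\<^sup>+x. (indicator B x)\<^sup>2 \<partial>Q a) = (\<integral>\<^sup>+x. indicator B x \<partial>Q a)"
    by (intro nn_integral_cong) (auto simp: indicator_def)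
  also have "\<dots> = emeasure (Q a) B" by simp
  also have "(\<integral>\<^sup>+x. (R x)\<^sup>2 \<partial>Q a) = (\<Prod>i\<in>K. \<integral>\<^sup>+x. ennreal ((r i x)\<^sup>2) \<partial>?N a i)"
    unfolding Q_def R_def prod_power_distrib ennreal_power[OF less_imp_le[OF exp_gt_zero], folded r_def]
    using K by (subst a.product_nn_integral_prod) (auto simp: r_def ennreal_power)
  also have "\<dots> = ennreal (exp (\<Sum>i\<in>K. (b i - a i)\<^sup>2 / (\<sigma> i)\<^sup>2))"
    unfolding r_def by (simp add: nn_integral_normal_shift_square \<sigma> exp_sum K prod_ennreal)
  finally show ?thesis .
qed

subsection \<open>Laws of the observation\<close>

text \<open>The interval has finite measure and \<open>\<bar>y\<bar> \<le> 1 + y\<^sup>2\<close>, so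
  square integrability implies integrability. This makes the drift of the observation a genuine
  integral.\<close>

lemma L2_functions_set_integrable:
  assumes "f \<in> L2_functions" "A \<in> sets lebesgue" "A \<subseteq> obs_interval"
  shows "set_integrable lebesgue A f"
proof -
  interpret finite_measure "lebesgue_on obs_interval"
    by (rule finite_measure_lebesgue_on) auto
  have "integrable (lebesgue_on obs_interval) f"
  proof (rule Bochner_Integration.integrable_bound)
    show "integrable (lebesgue_on obs_interval) (\<lambda>t. 1 + (f t)\<^sup>2)"
      using assms by (intro Bochner_Integration.integrable_add) (auto simp: L2_functions_def)
    have "\<bar>y\<bar> \<le> 1 + y\<^sup>2" for y :: real
      using zero_le_power2[of "\<bar>y\<bar> - 1"] by (simp add: power2_diff)
    then show "AE t in lebesgue_on obs_interval. norm (f t) \<le> norm (1 + (f t)\<^sup>2)"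
      by (auto intro!: AE_I2)
  qed (use assms in \<open>auto simp: L2_functions_def\<close>)
  then have "set_integrable lebesgue obs_interval f"
    unfolding set_integrable_def by (subst (asm) integrable_restrict_space) auto
  then show ?thesis using assms by (rule_tac set_integrable_subset) auto
qed

lemma L2_functions_diff_square_integrable:
  assumes "f \<in> L2_functions" "g \<in> L2_functions"
  shows "integrable (lebesgue_on obs_interval) (\<lambda>t. (g t - f t)\<^sup>2)"
proof (rule Bochner_Integration.integrable_bound)
  show "integrable (lebesgue_on obs_interval) (\<lambda>t. 2 * (g t)\<^sup>2 + 2 * (f t)\<^sup>2)"
    using assms by (intro Bochner_Integration.integrable_add integrable_mult_right) (auto simp: L2_functions_def)
  have "(x - y)\<^sup>2 \<le> 2 * x\<^sup>2 + 2 * y\<^sup>2" for x y :: real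
    using zero_le_power2[of "x + y"] unfolding power2_sum power2_diff by linarith
  then show "AE t in lebesgue_on obs_interval. norm ((g t - f t)\<^sup>2) \<le> norm (2 * (g t)\<^sup>2 + 2 * (f t)\<^sup>2)"
    by (auto intro!: AE_I2)
qed (use assms in \<open>auto simp: L2_functions_def\<close>)

text \<open>With \<open>m\<close> the mean of \<open>h\<close> over the interval, it suffices to
  expand the nonnegative integral of \<open>(h u - m)\<^sup>2\<close>.\<close>

lemma set_integral_Cauchy_Schwarz_interval:
  fixes h :: "real \<Rightarrow> real"
  assumes "s < t" and h: "set_integrable lebesgue {s<..t} h"
    and h2: "set_integrable lebesgue {s<..t} (\<lambda>u. (h u)\<^sup>2)"
  shows "(set_lebesgue_integral lebesgue {s<..t} h)\<^sup>2 / (t - s)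
    \<le> set_lebesgue_integral lebesgue {s<..t} (\<lambda>u. (h u)\<^sup>2)"
proof -
  let ?I = "set_lebesgue_integral lebesgue {s<..t} h"
  define m where "m = ?I / (t - s)"
  have c: "set_integrable lebesgue {s<..t} (\<lambda>u. m\<^sup>2)"
    unfolding set_integrable_def using \<open>s < t\<close> by (intro integrable_scaleR_left) (auto simp: integrable_indicator_iff)
  have "0 \<le> set_lebesgue_integral lebesgue {s<..t} (\<lambda>u. (h u - m)\<^sup>2)"
    unfolding set_lebesgue_integral_def by (intro integral_nonneg_AE) auto
  also have "(\<lambda>u. (h u - m)\<^sup>2) = (\<lambda>u. (h u)\<^sup>2 - 2 * m * h u + m\<^sup>2)"
    by (simp add: power2_eq_square algebra_simps)
  also have "set_lebesgue_integral lebesgue {s<..t} (\<lambda>u. (h u)\<^sup>2 - 2 * m * h u + m\<^sup>2)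
      = set_lebesgue_integral lebesgue {s<..t} (\<lambda>u. (h u)\<^sup>2) - 2 * m * ?I + (t - s) * m\<^sup>2"
    using \<open>s < t\<close> h h2 c
    by (simp add: set_integral_add set_integral_diff set_integral_const)
  also have "2 * m * ?I = 2 * (?I\<^sup>2 / (t - s))" by (simp add: m_def power2_eq_square)
  also have "(t - s) * m\<^sup>2 = ?I\<^sup>2 / (t - s)" using \<open>s < t\<close> by (simp add: m_def power2_eq_square)
  finally show ?thesis by simp
qed

lemma set_integral_initial_segment_diff:
  fixes u :: "real \<Rightarrow> real"
  assumes "set_integrable lebesgue obs_interval u" "s \<in> obs_interval" "t \<in> obs_interval" "s \<le> t"
  shows "set_lebesgue_integral lebesgue {-1/2..t} u - set_lebesgue_integral lebesgue {-1/2..s} u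
    = set_lebesgue_integral lebesgue {s<..t} u"
proof -
  have "{-1/2..t} = {-1/2..s} \<union> {s<..t}" using assms by auto
  then have "set_lebesgue_integral lebesgue {-1/2..t} u
      = set_lebesgue_integral lebesgue ({-1/2..s} \<union> {s<..t}) u" by simp
  also have "\<dots> = set_lebesgue_integral lebesgue {-1/2..s} u + set_lebesgue_integral lebesgue {s<..t} u"
    using assms by (intro set_integral_Un set_integrable_subset[OF assms(1)]) auto
  finally show ?thesis by simp
qed

text \<open>Multiplied by \<open>n\<close>, the sum is the exponent in the Gaussian shift bound for
  the increments of the observation over a mesh. Each term is at most the energy of
  \<open>g - f\<close> on its cell, and these energies telescope.\<close>

lemma sum_increments_le_L2_dist:
  assumes f: "f \<in> L2_functions" and g: "g \<in> L2_functions"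
    and t: "\<And>i. i \<le> k \<Longrightarrow> t i \<in> obs_interval" "\<And>i. i < k \<Longrightarrow> t i < t (Suc i)"
  defines "P \<equiv> \<lambda>f s. set_lebesgue_integral lebesgue {-1/2..s} f"
  shows "(\<Sum>i<k. ((P g (t (Suc i)) - P g (t i)) - (P f (t (Suc i)) - P f (t i)))\<^sup>2 / (t (Suc i) - t i))
    \<le> (L2_dist g f)\<^sup>2"
proof -
  let ?h = "\<lambda>u. g u - f u"
  let ?h2 = "\<lambda>u. (?h u)\<^sup>2"
  have int: "set_integrable lebesgue A g" "set_integrable lebesgue A f"
    if "A \<in> sets lebesgue" "A \<subseteq> obs_interval" for A
    using L2_functions_set_integrable[OF g that] L2_functions_set_integrable[OF f that] by auto
  have h: "set_integrable lebesgue obs_interval ?h"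
    using int by (intro set_integral_diff) auto
  have h2: "set_integrable lebesgue obs_interval ?h2"
    using L2_functions_diff_square_integrable[OF f g] unfolding set_integrable_def
    by (subst (asm) integrable_restrict_space) auto
  have "(\<Sum>i<k. ((P g (t (Suc i)) - P g (t i)) - (P f (t (Suc i)) - P f (t i)))\<^sup>2 / (t (Suc i) - t i))
      \<le> (\<Sum>i<k. P ?h2 (t (Suc i)) - P ?h2 (t i))"
  proof (intro sum_mono)
    fix i assume "i \<in> {..<k}"
    then have i: "t i \<in> obs_interval" "t (Suc i) \<in> obs_interval" "t i < t (Suc i)"
      using t by auto
    then have sub: "{t i<..t (Suc i)} \<subseteq> obs_interval" by auto
    have "(P g (t (Suc i)) - P g (t i)) - (P f (t (Suc i)) - P f (t i))
        = set_lebesgue_integral lebesgue {t i<..t (Suc i)} g - set_lebesgue_integral lebesgue {t i<..t (Suc i)} f"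
      using i int[of obs_interval] unfolding P_def
      by (subst (1 2) set_integral_initial_segment_diff) auto
    also have "\<dots> = set_lebesgue_integral lebesgue {t i<..t (Suc i)} ?h"
      using int[OF _ sub] by (simp add: set_integral_diff)
    finally have "((P g (t (Suc i)) - P g (t i)) - (P f (t (Suc i)) - P f (t i)))\<^sup>2 / (t (Suc i) - t i)
        = (set_lebesgue_integral lebesgue {t i<..t (Suc i)} ?h)\<^sup>2 / (t (Suc i) - t i)"
      by simp
    also have "\<dots> \<le> set_lebesgue_integral lebesgue {t i<..t (Suc i)} ?h2"
      using i sub by (intro set_integral_Cauchy_Schwarz_interval set_integrable_subset[OF h] set_integrable_subset[OF h2]) auto
    also have "\<dots> = P ?h2 (t (Suc i)) - P ?h2 (t i)"
      unfolding P_def using i by (intro set_integral_initial_segment_diff[symmetric] h2) auto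
    finally show "((P g (t (Suc i)) - P g (t i)) - (P f (t (Suc i)) - P f (t i)))\<^sup>2 / (t (Suc i) - t i)
        \<le> P ?h2 (t (Suc i)) - P ?h2 (t i)" .
  qed
  also have "\<dots> = P ?h2 (t k) - P ?h2 (t 0)"
    by (rule sum_lessThan_telescope)
  \<comment> \<open>The mesh need not reach the end points of the interval; extending it only adds
    energy, since \<open>?h2\<close> is nonnegative.\<close>
  also have "\<dots> \<le> P ?h2 (t k)"
    unfolding P_def set_lebesgue_integral_def by (simp add: integral_nonneg_AE)
  also have "\<dots> \<le> P ?h2 (1/2)"
  proof -
    have "0 \<le> P ?h2 (1/2) - P ?h2 (t k)"
      unfolding P_def using t(1)[of k] h2
      by (subst set_integral_initial_segment_diff) (auto simp: set_lebesgue_integral_def intro!: integral_nonneg_AE)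
    then show ?thesis by simp
  qed
  also have "\<dots> = (L2_dist g f)\<^sup>2"
    unfolding P_def L2_dist_def set_lebesgue_integral_def
    by (subst integral_restrict_space) (auto intro!: integral_nonneg_AE real_sqrt_pow2[symmetric])
  finally show ?thesis .
qed

section \<open>Paths of the observation and their events\<close>

text \<open>The Lebesgue integral of the drift agrees with the gauge integral, whose indefinite form
  is continuous.\<close>

lemma continuous_on_observation:
  assumes "standard_brownian_motion M W" "f \<in> L2_functions" "x \<in> space M"
  shows "continuous_on obs_interval (observation W n f x)"
proof -
  have f: "set_integrable lebesgue A f" if "A \<in> sets lebesgue" "A \<subseteq> obs_interval" for A
    using L2_functions_set_integrable[OF assms(2) that] .
  have "continuous_on obs_interval (\<lambda>t. integral {-1/2..t} f)"
    using f[of obs_interval] by (intro indefinite_integral_continuous_1 set_lebesgue_integral_eq_integral(1)) auto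
  moreover have "integral {-1/2..t} f = set_lebesgue_integral lebesgue {-1/2..t} f" if "t \<in> obs_interval" for t
    using f[of "{-1/2..t}"] that by (intro set_lebesgue_integral_eq_integral(2)[symmetric]) auto
  ultimately have "continuous_on obs_interval (\<lambda>t. set_lebesgue_integral lebesgue {-1/2..t} f)"
    by (rule continuous_on_eq)
  moreover have "continuous_on obs_interval (\<lambda>t. W t x)"
    using assms by (auto simp: standard_brownian_motion_def)
  ultimately have "continuous_on obs_interval
      (\<lambda>t. set_lebesgue_integral lebesgue {-1/2..t} f + W t x * (1 / sqrt (real n)))"
    by (intro continuous_intros)
  then show ?thesis
    by (rule continuous_on_eq) (simp add: observation_def)
qed

lemma observation_measurable_PiM:
  assumes "standard_brownian_motion M W"
  shows "observation W n f \<in> M \<rightarrow>\<^sub>M (\<Pi>\<^sub>M t\<in>obs_interval. borel)"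
  unfolding observation_def
proof (rule measurable_restrict)
  fix t assume "t \<in> obs_interval"
  then have [measurable]: "W t \<in> borel_measurable M"
    using assms unfolding standard_brownian_motion_def by blast
  show "(\<lambda>x. set_lebesgue_integral lebesgue {-1/2..t} f + W t x / sqrt (real n)) \<in> borel_measurable M"
    by measurable
qed

lemma observation_measurable:
  assumes "standard_brownian_motion M W" "f \<in> L2_functions"
  shows "observation W n f \<in> M \<rightarrow>\<^sub>M path_space"
  unfolding path_space_def
  by (intro measurable_restrict_space2 observation_measurable_PiM assms)
     (use continuous_on_observation[OF assms] in auto)

text \<open>The values at finitely many times are partial sums of increments over a mesh containing
  these times. The increments are independent normals whose variances do not depend on the signal,
  so the bound for shifted product Gaussians applies.\<close>

lemma observation_cylinder_bound:
  assumes BM: "standard_brownian_motion M W" and f: "f \<in> L2_functions" and g: "g \<in> L2_functions"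
    and "n \<ge> 1" and J: "finite J" "J \<subseteq> obs_interval" and B[measurable]: "B \<in> sets (PiM J (\<lambda>_. borel))"
  shows "(emeasure M {x \<in> space M. restrict (observation W n g x) J \<in> B})\<^sup>2
    \<le> ennreal (exp (n * (L2_dist g f)\<^sup>2)) * emeasure M {x \<in> space M. restrict (observation W n f x) J \<in> B}"
proof -
  interpret prob_space M using BM by (simp add: standard_brownian_motion_def)
  \<comment> \<open>The path starts at 0 in the left end point, which lets its values be recovered
    from increments. The two end points together guarantee at least one increment, that is, a
    nonempty index set for the product law.\<close>
  define K where "K = J \<union> {-1/2, 1/2}"
  have "finite K" using J(1) by (simp add: K_def)
  define L where "L = sorted_list_of_set K"
  define t where "t i = L ! i" for i
  define k where "k = length L - 1"
  have setL: "set L = J \<union> {-1/2, 1/2}" and dist: "distinct L" and sort: "sorted L"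
    using \<open>finite K\<close> unfolding L_def K_def[symmetric] by simp_all
  have "card {-1/2, 1/2 :: real} \<le> card (set L)"
    unfolding setL using J(1) by (intro card_mono) auto
  moreover have "card {-1/2, 1/2 :: real} = 2" by simp
  ultimately have "length L \<ge> 2"
    using distinct_card[OF dist] by simp
  then have lenL: "length L = Suc k" "k > 0"
    by (simp_all add: k_def)
  have t_in: "t i \<in> obs_interval" if "i \<le> k" for i
    using nth_mem[of i L] that lenL J setL unfolding t_def by auto
  have t_less: "t i < t j" if "i < j" "j \<le> k" for i j
    using that dist sort lenL unfolding t_def
    by (simp add: sorted_wrt_nth_less strict_sorted_iff)
  have t_surj: "\<exists>i\<le>k. t i = s" if "s \<in> J \<union> {-1/2, 1/2}" for s
    using that lenL unfolding setL[symmetric] in_set_conv_nth t_def by (auto simp: less_Suc_eq_le)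
  have t0: "t 0 = -1/2"
  proof -
    obtain i where i: "i \<le> k" "t i = -1/2" using t_surj[of "-1/2"] by auto
    then have "i = 0" using t_less[of 0 i] t_in[of 0] by (cases "i = 0") auto
    then show ?thesis using i by simp
  qed
  define idx where "idx s = (SOME i. i \<le> k \<and> t i = s)" for s
  have idx: "idx s \<le> k" "t (idx s) = s" if "s \<in> J" for s
    using someI_ex[OF t_surj[of s]] that unfolding idx_def by auto
  define F where "F f s = set_lebesgue_integral lebesgue {-1/2..s} f" for f :: "real \<Rightarrow> real" and s
  define m where "m f i = F f (t (Suc i)) - F f (t i)" for f i
  \<comment> \<open>The standard deviation of the \<open>i\<close>-th increment of the observation;
    the value 1 elsewhere only provides positivity at every index.\<close>
  define \<sigma> where "\<sigma> i = (if i < k then sqrt (t (Suc i) - t i) / sqrt n else 1)" for i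
  have \<sigma>: "\<sigma> i > 0" for i
    using t_less[of i "Suc i"] \<open>n \<ge> 1\<close> unfolding \<sigma>_def by auto
  define V where "V i x = (W (t (Suc i)) x - W (t i) x) / sqrt n" for i x
  have W_meas[measurable]: "W s \<in> borel_measurable M" if "s \<in> obs_interval" for s
    using BM that unfolding standard_brownian_motion_def by blast
  have V_meas[measurable]: "V i \<in> borel_measurable M" if "i < k" for i
    using W_meas[OF t_in[of i]] W_meas[OF t_in[of "Suc i"]] that unfolding V_def by simp
  define Z where "Z f x = (\<lambda>i\<in>{..<k}. m f i + V i x)" for f x
  have Z_meas[measurable]: "Z f \<in> M \<rightarrow>\<^sub>M PiM {..<k} (\<lambda>_. borel)" for f
    unfolding Z_def by (intro measurable_restrict) auto
  let ?Q = "\<lambda>m. PiM {..<k} (\<lambda>i. density lborel (normal_density (m i) (\<sigma> i)))"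
  have distrZ: "distr M (PiM {..<k} (\<lambda>_. borel)) (Z f) = ?Q (m f)" for f
  proof -
    have "indep_vars (\<lambda>_. borel) (\<lambda>i x. W (t (Suc i)) x - W (t i) x) {..<k}"
    proof -
      have "mono_on {..k} t"
        using t_less by (intro mono_onI) (metis atMost_iff le_less order_refl)
      moreover have "t ` {..k} \<subseteq> obs_interval" using t_in by auto
      ultimately show ?thesis using BM unfolding standard_brownian_motion_def by blast
    qed
    then have "indep_vars (\<lambda>_. borel) (\<lambda>i x. m f i + (W (t (Suc i)) x - W (t i) x) / sqrt n) {..<k}"
      by (rule indep_vars_compose2) auto
    then have "indep_vars (\<lambda>_. borel) (\<lambda>i x. m f i + V i x) {..<k}"
      unfolding V_def .
    then have "distr M (PiM {..<k} (\<lambda>_. borel)) (Z f) = PiM {..<k} (\<lambda>i. distr M borel (\<lambda>x. m f i + V i x))"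
      unfolding Z_def using \<open>k > 0\<close> by (subst (asm) indep_vars_iff_distr_eq_PiM') auto
    also have "\<dots> = ?Q (m f)"
    proof (intro PiM_cong refl)
      fix i assume "i \<in> {..<k}"
      then have i: "i < k" by simp
      have "distributed M lborel (\<lambda>x. W (t (Suc i)) x - W (t i) x) (normal_density 0 (sqrt (t (Suc i) - t i)))"
        using BM t_less[of i "Suc i"] t_in[of i] t_in[of "Suc i"] i unfolding standard_brownian_motion_def by simp
      then have "distributed M lborel (\<lambda>x. m f i + (1 / sqrt n) * (W (t (Suc i)) x - W (t i) x))
          (normal_density (m f i + (1 / sqrt n) * 0) (\<bar>1 / sqrt n\<bar> * sqrt (t (Suc i) - t i)))"
        using t_less[of i "Suc i"] i \<open>n \<ge> 1\<close> by (intro normal_density_affine) auto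
      then have "distributed M lborel (\<lambda>x. m f i + V i x) (normal_density (m f i) (\<sigma> i))"
        using i by (simp add: V_def \<sigma>_def)
      then show "distr M borel (\<lambda>x. m f i + V i x) = density lborel (normal_density (m f i) (\<sigma> i))"
        by (simp add: distributed_def cong: distr_cong)
    qed
    finally show ?thesis .
  qed
  \<comment> \<open>\<open>B'\<close> is the cylinder condition \<open>B\<close> rewritten in terms
    of the increments.\<close>
  define B' where "B' = {v \<in> space (PiM {..<k} (\<lambda>_. borel)). (\<lambda>s\<in>J. \<Sum>i<idx s. v i) \<in> B}"
  have "(\<lambda>v. \<lambda>s\<in>J. \<Sum>i<idx s. v i) \<in> PiM {..<k} (\<lambda>_. borel :: real measure) \<rightarrow>\<^sub>M PiM J (\<lambda>_. borel)"
    using idx by (intro measurable_restrict borel_measurable_sum measurable_component_singleton) (auto dest: order_less_le_trans)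
  then have B'[measurable]: "B' \<in> sets (PiM {..<k} (\<lambda>_. borel))"
    unfolding B'_def using measurable_sets[OF _ B] by (simp add: vimage_def Int_def conj_commute)
  \<comment> \<open>The partial sums recover the path because the integrated drift and the Brownian
    motion both vanish at \<open>t 0\<close>.\<close>
  have obs: "restrict (observation W n f x) J = (\<lambda>s\<in>J. \<Sum>i<idx s. Z f x i)" if "x \<in> space M" for f x
  proof (intro restrict_ext)
    fix s assume s: "s \<in> J"
    have F0: "F f (t 0) = 0"
      unfolding F_def t0 set_lebesgue_integral_def
      by (intro integral_eq_zero_AE AE_I[where N="{-1/2}"]) (auto simp: indicator_def)
    have W0: "W (t 0) x = 0" using BM that unfolding standard_brownian_motion_def t0 by blast
    have "(\<Sum>i<idx s. Z f x i) = (\<Sum>i<idx s. (F f (t (Suc i)) - F f (t i)) + (W (t (Suc i)) x - W (t i) x) / sqrt n)"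
      using idx[OF s] by (intro sum.cong) (auto simp: Z_def m_def V_def)
    also have "\<dots> = F f s + W s x / sqrt n"
      using idx[OF s] F0 W0
      by (simp add: sum.distrib sum_divide_distrib[symmetric]
          sum_lessThan_telescope[of "\<lambda>i. F f (t i)"] sum_lessThan_telescope[of "\<lambda>i. W (t i) x"])
    also have "\<dots> = observation W n f x s"
      using s J by (auto simp: observation_def F_def)
    finally show "observation W n f x s = (\<Sum>i<idx s. Z f x i)" by simp
  qed
  have ev: "emeasure M {x \<in> space M. restrict (observation W n f x) J \<in> B} = emeasure (?Q (m f)) B'" for f
  proof -
    have "emeasure (?Q (m f)) B' = emeasure M (Z f -` B' \<inter> space M)"
      unfolding distrZ[symmetric] by (intro emeasure_distr) auto
    also have "Z f -` B' \<inter> space M = {x \<in> space M. restrict (observation W n f x) J \<in> B}"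
      using measurable_space[OF Z_meas] by (auto simp: B'_def obs)
    finally show ?thesis ..
  qed
  have "(emeasure (?Q (m g)) B')\<^sup>2
      \<le> ennreal (exp (\<Sum>i<k. (m g i - m f i)\<^sup>2 / (\<sigma> i)\<^sup>2)) * emeasure (?Q (m f)) B'"
    by (intro product_normal_shift \<sigma> B') auto
  also have "(\<Sum>i<k. (m g i - m f i)\<^sup>2 / (\<sigma> i)\<^sup>2) \<le> n * (L2_dist g f)\<^sup>2"
  proof -
    have "(\<Sum>i<k. (m g i - m f i)\<^sup>2 / (\<sigma> i)\<^sup>2)
        = n * (\<Sum>i<k. (m g i - m f i)\<^sup>2 / (t (Suc i) - t i))"
      unfolding sum_distrib_left
    proof (intro sum.cong refl)
      fix i assume "i \<in> {..<k}"
      then show "(m g i - m f i)\<^sup>2 / (\<sigma> i)\<^sup>2 = n * ((m g i - m f i)\<^sup>2 / (t (Suc i) - t i))"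
        using t_less[of i "Suc i"] by (simp add: \<sigma>_def power_divide)
    qed
    also have "\<dots> \<le> n * (L2_dist g f)\<^sup>2"
      unfolding m_def F_def
      by (intro mult_left_mono sum_increments_le_L2_dist f g t_in t_less) auto
    finally show ?thesis .
  qed
  finally show ?thesis
    unfolding ev by (simp add: mult_right_mono ennreal_leI)
qed

text \<open>
  The second moment bound of the likelihood ratio, stated for events only: an existence proof of the
  density (Cameron--Martin) is avoided, since the inequality passes from cylinder sets to the
  generated \<open>\<sigma>\<close>-algebra.
\<close>

lemma observation_event_bound:
  assumes BM: "standard_brownian_motion M W" and f: "f \<in> L2_functions" and g: "g \<in> L2_functions"
    and "n \<ge> 1" and A: "A \<in> sets (\<Pi>\<^sub>M t\<in>obs_interval. borel)"
  shows "(measure M {x \<in> space M. observation W n g x \<in> A})\<^sup>2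
    \<le> exp (n * (L2_dist g f)\<^sup>2) * measure M {x \<in> space M. observation W n f x \<in> A}"
proof -
  interpret prob_space M using BM by (simp add: standard_brownian_motion_def)
  let ?S = "\<Pi>\<^sub>M t\<in>obs_interval. (borel :: real measure)"
  let ?X = "observation W n"
  let ?C = "exp (n * (L2_dist g f)\<^sup>2)"
  let ?D = "\<lambda>f. distr M ?S (?X f)"
  have X[measurable]: "?X f \<in> M \<rightarrow>\<^sub>M ?S" for f
    using BM by (rule observation_measurable_PiM)
  have prob_D: "prob_space (?D f)" for f by (intro prob_space_distr X)
  interpret Df: prob_space "?D f" by (rule prob_D)
  interpret Dg: prob_space "?D g" by (rule prob_D)
  have XJ: "(\<lambda>x. restrict (?X f x) J) \<in> M \<rightarrow>\<^sub>M PiM J (\<lambda>_. borel)" if "J \<subseteq> obs_interval" for J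
    using measurable_comp[OF X measurable_restrict_subset[OF that]] by (simp add: comp_def)
  \<comment> \<open>The finite-dimensional laws form a projective family; its
    \<open>generator\<close> is the algebra of cylinder sets, which generates the product
    \<sigma>-algebra.\<close>
  have "projective_family obs_interval (\<lambda>J. distr M (PiM J (\<lambda>_. borel)) (\<lambda>x. restrict (?X f x) J))
      (\<lambda>_. borel :: real measure)"
  proof (rule projective_family.intro)
    fix J H :: "real set" assume JH: "J \<subseteq> H" "finite H" "H \<subseteq> obs_interval"
    show "distr M (Pi\<^sub>M J (\<lambda>_. borel)) (\<lambda>x. restrict (?X f x) J)
      = distr (distr M (Pi\<^sub>M H (\<lambda>_. borel)) (\<lambda>x. restrict (?X f x) H)) (Pi\<^sub>M J (\<lambda>_. borel)) (\<lambda>f. restrict f J)"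
      using JH XJ by (subst distr_distr) (auto intro!: measurable_restrict_subset distr_cong simp: comp_def Int_absorb1)
  next
    fix J :: "real set" assume "finite J" "J \<subseteq> obs_interval"
    then show "prob_space (distr M (Pi\<^sub>M J (\<lambda>_. borel)) (\<lambda>x. restrict (?X f x) J))"
      by (intro prob_space_distr XJ)
  qed
  then interpret projective_family obs_interval "\<lambda>J. distr M (PiM J (\<lambda>_. borel)) (\<lambda>x. restrict (?X f x) J)"
    "\<lambda>_. borel :: real measure" .
  have gen: "(measure (?D g) B)\<^sup>2 \<le> ?C * measure (?D f) B" if B: "B \<in> generator" for B
  proof -
    obtain J Y where J: "finite J" "J \<subseteq> obs_interval" and Y: "Y \<in> sets (PiM J (\<lambda>_. borel))"
      and B_eq: "B = prod_emb obs_interval (\<lambda>_. borel) J Y"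
      using B by cases
    have B_sets: "B \<in> sets ?S" unfolding B_eq using J Y by auto
    have ev: "emeasure M {x \<in> space M. restrict (?X h x) J \<in> Y} = ennreal (measure (?D h) B)" for h
    proof -
      have "?X h -` B \<inter> space M = {x \<in> space M. restrict (?X h x) J \<in> Y}"
        using measurable_space[OF X[of h]] by (auto simp: B_eq prod_emb_iff space_PiM PiE_iff)
      then show ?thesis unfolding measure_distr[OF X B_sets] by (simp add: emeasure_eq_measure)
    qed
    show ?thesis
      using observation_cylinder_bound[OF BM f g \<open>n \<ge> 1\<close> J Y] unfolding ev
      by (simp add: ennreal_power ennreal_mult[symmetric])
  qed
  have main: "(measure (?D g) A)\<^sup>2 \<le> ?C * measure (?D f) A"
  proof (rule field_le_epsilon)
    fix e :: real assume "e > 0"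
    \<comment> \<open>Replacing \<open>A\<close> by \<open>B\<close> costs at most
      \<open>2 * d\<close> in the squared probability under \<open>g\<close> and
      \<open>?C * d\<close> on the side of \<open>f\<close>; together this is
      \<open>e\<close>.\<close>
    define d where "d = e / (2 + ?C)"
    have "2 + ?C > 0" by (simp add: add_pos_pos)
    then have d: "d > 0" "(2 + ?C) * d = e"
      using \<open>e > 0\<close> by (simp_all add: d_def)
    obtain B where B: "B \<in> generator"
      and BD: "measure (?D f) (sym_diff A B) < d" "measure (?D g) (sym_diff A B) < d"
      using approx_by_algebra[OF algebra_generator, of "?D f" "?D g" A d] sets_PiM_generator A d
        Df.finite_measure_axioms Dg.finite_measure_axioms by auto
    have B_sets: "B \<in> sets ?S" using B sets_PiM_generator by auto
    have dif: "measure (?D h) U \<le> measure (?D h) V + measure (?D h) (sym_diff A B)"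
      if "(U = A \<and> V = B) \<or> (U = B \<and> V = A)" for h U V
    proof -
      interpret Dh: prob_space "?D h" by (rule prob_D)
      have "measure (?D h) U \<le> measure (?D h) (V \<union> sym_diff A B)"
        using that A B_sets by (intro Dh.finite_measure_mono) auto
      also have "\<dots> \<le> measure (?D h) V + measure (?D h) (sym_diff A B)"
        using that A B_sets by (intro measure_Un_le) auto
      finally show ?thesis .
    qed
    let ?a = "measure (?D g) A" and ?b = "measure (?D g) B"
    have ab: "?a \<le> ?b + d" "measure (?D f) B \<le> measure (?D f) A + d"
      using dif[of A B g] dif[of B A f] BD by auto
    have "?a\<^sup>2 - ?b\<^sup>2 = (?a - ?b) * (?a + ?b)" by (simp add: power2_eq_square algebra_simps)
    also have "\<dots> \<le> d * 2"
    proof (cases "?a \<le> ?b")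
      case True
      then have "(?a - ?b) * (?a + ?b) \<le> 0" by (intro mult_nonpos_nonneg) auto
      then show ?thesis using d by simp
    next
      case False
      then show ?thesis using ab Dg.prob_le_1[of A] Dg.prob_le_1[of B] by (intro mult_mono) auto
    qed
    finally have "?a\<^sup>2 \<le> ?b\<^sup>2 + 2 * d" by simp
    also have "?b\<^sup>2 \<le> ?C * measure (?D f) B" by (rule gen[OF B])
    also have "\<dots> \<le> ?C * (measure (?D f) A + d)" using ab by simp
    finally show "?a\<^sup>2 \<le> ?C * measure (?D f) A + e"
      using d by (simp add: algebra_simps)
  qed
  have "measure (?D h) A = measure M {x \<in> space M. ?X h x \<in> A}" for h
    unfolding measure_distr[OF X A] by (simp add: vimage_def Int_def conj_commute)
  then show ?thesis using main by simp
qed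

subsection \<open>Risk bounds\<close>

text \<open>Let \<open>A\<close> be the event that the estimate is at least
  \<open>3 / 4 * \<Delta>\<close> away from \<open>T f\<close>. Markov's inequality at
  \<open>f\<close> and \<open>close\<close> bound the squared probability of \<open>A\<close> under
  \<open>g\<close> by 16/9 times 4/9, the square of 8/9. So the complement has probability at least
  1/9 under \<open>g\<close>, and there the error for \<open>T g\<close> is at least a quarter of
  \<Delta>; 1/16 times 1/9 is 1/144.\<close>

lemma mse_two_point_bound:
  assumes BM: "standard_brownian_motion M W" and f: "f \<in> L2_functions" and g: "g \<in> L2_functions"
    and "n \<ge> 1" and S[measurable]: "S \<in> borel_measurable path_space"
    and risk: "mse M W n T S f \<le> ennreal (a\<^sup>2)"
    and close: "exp (n * (L2_dist g f)\<^sup>2) * a\<^sup>2 \<le> 4 / 9 * (T g - T f)\<^sup>2"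
  shows "ennreal ((T g - T f)\<^sup>2 / 144) \<le> mse M W n T S g"
proof (cases "T g = T f")
  case False
  interpret prob_space M using BM by (simp add: standard_brownian_motion_def)
  define \<Delta> where "\<Delta> = \<bar>T g - T f\<bar>"
  have \<Delta>: "\<Delta> > 0" "\<Delta>\<^sup>2 = (T g - T f)\<^sup>2" using False by (auto simp: \<Delta>_def)
  let ?X = "observation W n"
  have X[measurable]: "?X f \<in> M \<rightarrow>\<^sub>M path_space" "?X g \<in> M \<rightarrow>\<^sub>M path_space"
    using observation_measurable[OF BM] f g by auto
  define A where "A = {y \<in> space path_space. \<bar>S y - T f\<bar> \<ge> 3 / 4 * \<Delta>}"
  have A[measurable]: "A \<in> sets path_space" unfolding A_def by measurable
  let ?E = "\<lambda>h. {x \<in> space M. ?X h x \<in> A}"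
  have E[measurable]: "?E f \<in> sets M" "?E g \<in> sets M" by measurable
  \<comment> \<open>An event of \<open>path_space\<close> is the trace of an event of the full
    product. As the observed paths are continuous, both have the same preimage, and the event bound
    applies.\<close>
  obtain A' where A': "A' \<in> sets (\<Pi>\<^sub>M t\<in>obs_interval. (borel :: real measure))"
    and A_eq: "A = {y. continuous_on obs_interval y} \<inter> A'"
    using A unfolding path_space_def sets_restrict_space by auto
  have E_eq: "?E h = {x \<in> space M. ?X h x \<in> A'}" if "h \<in> L2_functions" for h
    using continuous_on_observation[OF BM that] unfolding A_eq by auto
  have chi: "(prob (?E g))\<^sup>2 \<le> exp (n * (L2_dist g f)\<^sup>2) * prob (?E f)"
    unfolding E_eq[OF f] E_eq[OF g] by (rule observation_event_bound[OF BM f g \<open>n \<ge> 1\<close> A'])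
  have "ennreal (9 / 16 * \<Delta>\<^sup>2 * prob (?E f)) = (\<integral>\<^sup>+x. ennreal (9 / 16 * \<Delta>\<^sup>2) * indicator (?E f) x \<partial>M)"
    by (subst nn_integral_cmult_indicator) (auto simp: emeasure_eq_measure ennreal_mult[symmetric])
  also have "\<dots> \<le> mse M W n T S f"
    unfolding mse_def
  proof (intro nn_integral_mono)
    fix x assume "x \<in> space M"
    have "9 / 16 * \<Delta>\<^sup>2 \<le> (S (?X f x) - T f)\<^sup>2" if "?X f x \<in> A"
      using that \<Delta>(1) power_mono[of "3 / 4 * \<Delta>" "\<bar>S (?X f x) - T f\<bar>" 2]
      by (simp add: A_def power_mult_distrib power_divide)
    then show "ennreal (9 / 16 * \<Delta>\<^sup>2) * indicator (?E f) x \<le> ennreal ((S (?X f x) - T f)\<^sup>2)"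
      by (auto simp: indicator_def intro: ennreal_leI)
  qed
  finally have "ennreal (9 / 16 * \<Delta>\<^sup>2 * prob (?E f)) \<le> ennreal (a\<^sup>2)"
    using risk by (rule order_trans)
  then have "9 / 16 * \<Delta>\<^sup>2 * prob (?E f) \<le> a\<^sup>2" by (simp add: ennreal_le_iff)
  then have "9 / 16 * \<Delta>\<^sup>2 * (exp (n * (L2_dist g f)\<^sup>2) * prob (?E f)) \<le> exp (n * (L2_dist g f)\<^sup>2) * a\<^sup>2"
    by (simp add: mult.left_commute[of "exp _"] del: times_divide_eq_left)
  moreover have "9 / 16 * \<Delta>\<^sup>2 * (prob (?E g))\<^sup>2 \<le> 9 / 16 * \<Delta>\<^sup>2 * (exp (n * (L2_dist g f)\<^sup>2) * prob (?E f))"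
    using chi by (intro mult_left_mono) auto
  ultimately have "9 / 16 * \<Delta>\<^sup>2 * (prob (?E g))\<^sup>2 \<le> 4 / 9 * \<Delta>\<^sup>2"
    using close unfolding \<Delta>(2)[symmetric] by linarith
  then have "\<Delta>\<^sup>2 * (prob (?E g))\<^sup>2 \<le> \<Delta>\<^sup>2 * (8 / 9)\<^sup>2" by (simp add: power_divide)
  then have "(prob (?E g))\<^sup>2 \<le> (8 / 9)\<^sup>2" using \<Delta>(1) by simp
  then have q: "prob (?E g) \<le> 8 / 9" by (rule power2_le_imp_le) simp
  have "\<Delta>\<^sup>2 / 144 \<le> \<Delta>\<^sup>2 / 16 * (1 - prob (?E g))"
    using q mult_left_mono[of "1 / 9" "1 - prob (?E g)" "\<Delta>\<^sup>2 / 16"] by simp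
  then have "ennreal (\<Delta>\<^sup>2 / 144) \<le> ennreal (\<Delta>\<^sup>2 / 16 * prob (space M - ?E g))"
    by (simp add: prob_compl ennreal_leI)
  also have "\<dots> = (\<integral>\<^sup>+x. ennreal (\<Delta>\<^sup>2 / 16) * indicator (space M - ?E g) x \<partial>M)"
    by (subst nn_integral_cmult_indicator) (auto simp: emeasure_eq_measure ennreal_mult[symmetric])
  also have "\<dots> \<le> mse M W n T S g"
    unfolding mse_def
  proof (intro nn_integral_mono)
    fix x assume x: "x \<in> space M"
    have "\<Delta>\<^sup>2 / 16 \<le> (S (?X g x) - T g)\<^sup>2" if "?X g x \<notin> A"
    proof -
      have "\<bar>S (?X g x) - T f\<bar> < 3 / 4 * \<Delta>"
        using that measurable_space[OF X(2) x] by (auto simp: A_def)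
      moreover have "\<Delta> \<le> \<bar>S (?X g x) - T f\<bar> + \<bar>S (?X g x) - T g\<bar>"
        unfolding \<Delta>_def by linarith
      ultimately have "\<Delta> / 4 \<le> \<bar>S (?X g x) - T g\<bar>" by linarith
      then show ?thesis
        using \<Delta>(1) power_mono[of "\<Delta> / 4" "\<bar>S (?X g x) - T g\<bar>" 2] by (simp add: power_divide)
    qed
    then show "ennreal (\<Delta>\<^sup>2 / 16) * indicator (space M - ?E g) x \<le> ennreal ((S (?X g x) - T g)\<^sup>2)"
      using x by (auto simp: indicator_def intro: ennreal_leI)
  qed
  finally show ?thesis by (simp add: \<Delta>(2))
qed simp

text \<open>If the difference exceeds the threshold \<open>b\<close>, then \<open>close\<close>
  supplies the hypothesis of the two-point bound, and the risk at \<open>g\<close> limits the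
  difference to \<open>12 * s\<close>, 12 being the root of 144. The threshold stays free, as
  different pairs call for different choices.\<close>

lemma functional_difference_bound:
  assumes BM: "standard_brownian_motion M W" and f: "f \<in> L2_functions" and g: "g \<in> L2_functions"
    and "n \<ge> 1" and S: "S \<in> borel_measurable path_space"
    and risk_f: "mse M W n T S f \<le> ennreal (a\<^sup>2)" and risk_g: "mse M W n T S g \<le> ennreal (s\<^sup>2)"
    and "s \<ge> 0" "b \<ge> 0"
    and close: "9 / 4 * (exp (n * (L2_dist g f)\<^sup>2) * a\<^sup>2) \<le> b\<^sup>2"
  shows "\<bar>T g - T f\<bar> \<le> max (12 * s) b"
proof (cases "\<bar>T g - T f\<bar> \<le> b")
  case False
  then have "b\<^sup>2 \<le> (T g - T f)\<^sup>2"
    using power_mono[of b "\<bar>T g - T f\<bar>" 2] \<open>b \<ge> 0\<close> by simp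
  then have "ennreal ((T g - T f)\<^sup>2 / 144) \<le> mse M W n T S g"
    using close by (intro mse_two_point_bound[OF BM f g \<open>n \<ge> 1\<close> S risk_f]) simp
  then have "ennreal ((T g - T f)\<^sup>2 / 144) \<le> ennreal (s\<^sup>2)"
    using risk_g by (rule order_trans)
  then have "\<bar>T g - T f\<bar>\<^sup>2 \<le> (12 * s)\<^sup>2" by (simp add: power_mult_distrib)
  then have "\<bar>T g - T f\<bar> \<le> 12 * s" by (rule power2_le_imp_le) (use \<open>s \<ge> 0\<close> in simp)
  then show ?thesis by simp
qed simp

section \<open>Bounds on the moduli\<close>

lemma between_modulus_le_iff:
  "between_modulus T \<epsilon> F1 F2 \<le> c \<longleftrightarrow>
    (\<forall>f\<in>F1. \<forall>g\<in>F2. ennreal (L2_dist g f) \<le> \<epsilon> \<longrightarrow> ennreal \<bar>T g - T f\<bar> \<le> c)"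
  unfolding between_modulus_def by (auto simp: Sup_le_iff)

lemma modulus_eq_between_modulus: "modulus T \<epsilon> F = between_modulus T \<epsilon> F F"
  unfolding modulus_def between_modulus_def ..

lemma L2_dist_nonneg: "L2_dist g f \<ge> 0"
  unfolding L2_dist_def by (simp add: integral_nonneg_AE)

text \<open>The logarithmic radius is the distance at which the likelihood-ratio factor reaches
  \<gamma>. For \<gamma> equal to \<open>exp 1\<close> it is the noise level.\<close>

lemma exp_L2_dist_le:
  assumes "n \<ge> 1" "\<gamma> \<ge> 1" "ennreal (L2_dist g f) \<le> ennreal (sqrt (ln \<gamma> / n))"
  shows "exp (n * (L2_dist g f)\<^sup>2) \<le> \<gamma>"
proof -
  have "L2_dist g f \<le> sqrt (ln \<gamma> / n)"
    using assms by (simp add: ennreal_le_iff)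
  then have "(L2_dist g f)\<^sup>2 \<le> (sqrt (ln \<gamma> / n))\<^sup>2"
    by (intro power_mono L2_dist_nonneg)
  then have "n * (L2_dist g f)\<^sup>2 \<le> ln \<gamma>"
    using assms by (simp add: field_simps)
  then have "exp (n * (L2_dist g f)\<^sup>2) \<le> exp (ln \<gamma>)" by simp
  then show ?thesis using assms by simp
qed

text \<open>This makes \<open>3 * x\<close> a valid threshold for pairs whose likelihood-ratio
  factor is at most \<open>exp 1\<close>.\<close>

lemma nine_fourths_exp_le: "9 / 4 * (exp 1 * x\<^sup>2) \<le> (3 * x)\<^sup>2" for x :: real
proof -
  have "exp 1 \<le> (3 :: real)" by (rule exp_le)
  then have "exp 1 * x\<^sup>2 \<le> 3 * x\<^sup>2" by (rule mult_right_mono) simp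
  then have "9 / 4 * (exp 1 * x\<^sup>2) \<le> 9 * x\<^sup>2" using zero_le_power2[of x] by linarith
  then show ?thesis by (simp add: power_mult_distrib)
qed

text \<open>This lets the between-class modulus itself serve as threshold when the quotient in
  \<open>gamma_n\<close> is at least \<open>exp 1\<close>.\<close>

lemma nine_fourths_le_exp_1: "9 / 4 \<le> exp (1 :: real)"
proof -
  have "(3 / 2)\<^sup>2 \<le> (exp (1 / 2 :: real))\<^sup>2"
    using exp_ge_add_one_self[of "1 / 2 :: real"] by (intro power_mono) auto
  also have "\<dots> = exp (2 * (1 / 2))" by (rule exp_double[symmetric])
  finally show ?thesis by (simp add: power_divide)
qed

text \<open>
  For \<open>a = cs * v > 0\<close> and \<open>u\<close> the between-class modulus at the noise level, a pair
  within the logarithmic radius has likelihood ratio of squared norm at most \<open>max (exp 1) (u / a)\<close>,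
  so its difference is at most \<open>12 * s\<close>, \<open>3 * a\<close> or \<open>u\<close>; and \<open>u\<close> obeys the
  same bound because the noise level corresponds to the ratio \<open>exp 1\<close>.
  For \<open>a = 0\<close> the radius may be infinite, but then no constraint on the distance is needed.
\<close>

lemma between_modulus_log_radius_le:
  assumes BM: "standard_brownian_motion M W" and F: "F1 \<subseteq> L2_functions" "F2 \<subseteq> L2_functions"
    and "n \<ge> 1" and S: "S \<in> borel_measurable path_space"
    and "cs > 0" "v \<ge> 0" and v: "modulus T (noise_level n) F1 = ennreal v"
    and risk1: "\<And>f. f \<in> F1 \<Longrightarrow> mse M W n T S f \<le> ennreal ((cs * v)\<^sup>2)"
    and risk2: "\<And>g. g \<in> F2 \<Longrightarrow> mse M W n T S g \<le> ennreal (s\<^sup>2)" and "s \<ge> 0"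
  shows "between_modulus T (log_radius (gamma_n T F1 F2 cs n) n) F1 F2 \<le> ennreal (max (12 * s) (3 * (cs * v)))"
proof -
  let ?a = "cs * v" and ?\<gamma> = "gamma_n T F1 F2 cs n"
  have a: "?a \<ge> 0" using \<open>cs > 0\<close> \<open>v \<ge> 0\<close> by simp
  have dif: "\<bar>T g - T f\<bar> \<le> max (12 * s) b"
    if "f \<in> F1" "g \<in> F2" "b \<ge> 0" "9 / 4 * (exp (n * (L2_dist g f)\<^sup>2) * ?a\<^sup>2) \<le> b\<^sup>2" for f g b
    using that F \<open>s \<ge> 0\<close> \<open>n \<ge> 1\<close>
    by (intro functional_difference_bound[OF BM _ _ _ S risk1 risk2]) auto
  have dif_e: "\<bar>T g - T f\<bar> \<le> max (12 * s) (3 * ?a)"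
    if "f \<in> F1" "g \<in> F2" "exp (n * (L2_dist g f)\<^sup>2) \<le> exp 1" for f g
  proof (rule dif[OF that(1,2)])
    have "9 / 4 * (exp (n * (L2_dist g f)\<^sup>2) * ?a\<^sup>2) \<le> 9 / 4 * (exp 1 * ?a\<^sup>2)"
      using that(3) by (intro mult_left_mono mult_right_mono) auto
    also have "\<dots> \<le> (3 * ?a)\<^sup>2" by (rule nine_fourths_exp_le)
    finally show "9 / 4 * (exp (n * (L2_dist g f)\<^sup>2) * ?a\<^sup>2) \<le> (3 * ?a)\<^sup>2" .
  qed (use a in simp)
  have "between_modulus T (noise_level n) F1 F2 \<le> ennreal (max (12 * s) (3 * ?a))"
    unfolding between_modulus_le_iff
  proof (intro ballI impI ennreal_leI dif_e)
    fix f g assume "ennreal (L2_dist g f) \<le> noise_level n"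
    then show "exp (n * (L2_dist g f)\<^sup>2) \<le> exp 1"
      using \<open>n \<ge> 1\<close> by (intro exp_L2_dist_le) (auto simp: noise_level_def real_sqrt_divide)
  qed
  \<comment> \<open>The modulus could be infinite a priori; the bound makes it a real number, so the
    quotient in \<open>gamma_n\<close> becomes a real quotient when \<open>?a\<close> is
    positive.\<close>
  then obtain u where u: "between_modulus T (noise_level n) F1 F2 = ennreal u" "u \<ge> 0"
      "u \<le> max (12 * s) (3 * ?a)"
    by (cases "between_modulus T (noise_level n) F1 F2")
       (use \<open>s \<ge> 0\<close> in \<open>auto simp: ennreal_le_iff le_max_iff_disj top_unique\<close>)
  show ?thesis
    unfolding between_modulus_le_iff
  proof (intro ballI impI ennreal_leI)
    fix f g assume fg: "f \<in> F1" "g \<in> F2" and close: "ennreal (L2_dist g f) \<le> log_radius ?\<gamma> n"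
    show "\<bar>T g - T f\<bar> \<le> max (12 * s) (3 * ?a)"
    proof (cases "?a = 0")
      case True
      then show ?thesis using dif[OF fg, of 0, unfolded True] \<open>s \<ge> 0\<close> unfolding True by simp
    next
      case False
      then have "?a > 0" using a by linarith
      define \<gamma> where "\<gamma> = max (exp 1) (u / ?a)"
      have "?\<gamma> = ennreal \<gamma>"
        unfolding gamma_n_def u(1) v \<gamma>_def using u(2) \<open>?a > 0\<close> \<open>cs > 0\<close> \<open>v \<ge> 0\<close>
        by (auto simp: ennreal_mult[symmetric] divide_ennreal max_def ennreal_le_iff)
      moreover have "\<gamma> \<ge> 1" unfolding \<gamma>_def by (simp add: le_max_iff_disj)
      ultimately have "exp (n * (L2_dist g f)\<^sup>2) \<le> \<gamma>"
        using close \<open>n \<ge> 1\<close> by (intro exp_L2_dist_le) (auto simp: log_radius_def)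
      then consider "exp (n * (L2_dist g f)\<^sup>2) \<le> exp 1"
        | "exp (n * (L2_dist g f)\<^sup>2) \<le> u / ?a" "exp 1 \<le> u / ?a"
        unfolding \<gamma>_def by (auto simp: max_def split: if_splits)
      then show ?thesis
      proof cases
        case 1
        then show ?thesis by (rule dif_e[OF fg])
      next
        case 2
        \<comment> \<open>The threshold is \<open>u\<close>: one factor \<open>?a\<close> cancels
          against the quotient, and the other, times 9/4, is at most \<open>u\<close>.\<close>
        have "9 / 4 * ?a \<le> exp 1 * ?a"
          using nine_fourths_le_exp_1 a by (rule mult_right_mono)
        also have "\<dots> \<le> u" using 2(2) \<open>?a > 0\<close> by (simp add: pos_le_divide_eq)
        finally have "9 / 4 * ?a \<le> u" .
        have "9 / 4 * (exp (n * (L2_dist g f)\<^sup>2) * ?a\<^sup>2) \<le> 9 / 4 * (u / ?a * ?a\<^sup>2)"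
          using 2(1) by (intro mult_left_mono mult_right_mono) auto
        also have "\<dots> = (9 / 4 * ?a) * u" using \<open>?a > 0\<close> by (simp add: power2_eq_square)
        also have "\<dots> \<le> u\<^sup>2"
          unfolding power2_eq_square using \<open>9 / 4 * ?a \<le> u\<close> u(2) by (rule mult_right_mono)
        finally have "\<bar>T g - T f\<bar> \<le> max (12 * s) u" by (intro dif fg u)
        then show ?thesis using u(3) by simp
      qed
    qed
  qed
qed

text \<open>Both functions lie in the same class, so \<open>s\<^sup>2\<close> bounds the risk at
  either of them; the threshold \<open>3 * s\<close> is absorbed by \<open>12 * s\<close>.\<close>

lemma modulus_noise_level_le:
  assumes BM: "standard_brownian_motion M W" and F: "F \<subseteq> L2_functions"
    and "n \<ge> 1" and S: "S \<in> borel_measurable path_space"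
    and risk: "\<And>g. g \<in> F \<Longrightarrow> mse M W n T S g \<le> ennreal (s\<^sup>2)" and "s \<ge> 0"
  shows "modulus T (noise_level n) F \<le> ennreal (12 * s)"
  unfolding modulus_eq_between_modulus between_modulus_le_iff
proof (intro ballI impI ennreal_leI)
  fix f g assume fg: "f \<in> F" "g \<in> F" and "ennreal (L2_dist g f) \<le> noise_level n"
  then have "exp (n * (L2_dist g f)\<^sup>2) \<le> exp 1"
    using \<open>n \<ge> 1\<close> by (intro exp_L2_dist_le) (auto simp: noise_level_def real_sqrt_divide)
  then have "9 / 4 * (exp (n * (L2_dist g f)\<^sup>2) * s\<^sup>2) \<le> 9 / 4 * (exp 1 * s\<^sup>2)"
    by (intro mult_left_mono mult_right_mono) auto
  also have "\<dots> \<le> (3 * s)\<^sup>2" by (rule nine_fourths_exp_le)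
  finally have "\<bar>T g - T f\<bar> \<le> max (12 * s) (3 * s)"
    using fg F \<open>s \<ge> 0\<close> \<open>n \<ge> 1\<close>
    by (intro functional_difference_bound[OF BM _ _ _ S risk risk]) auto
  then show "\<bar>T g - T f\<bar> \<le> 12 * s" using \<open>s \<ge> 0\<close> by simp
qed

section \<open>The lower bound over the second class and its constant\<close>

theorem theorem1:
  fixes M :: "'a measure" and W :: "real \<Rightarrow> 'a \<Rightarrow> real"
    and D F1 F2 :: "(real \<Rightarrow> real) set"
    and T :: "(real \<Rightarrow> real) \<Rightarrow> real"
    and That :: "nat \<Rightarrow> (real \<Rightarrow> real) \<Rightarrow> real"
    and \<epsilon>0 cs :: real
  assumes "standard_brownian_motion M W"
    and "linear_functional_on D T"
    and "F1 \<subseteq> D" and "F2 \<subseteq> D" and "F1 \<inter> F2 \<noteq> {}"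
    and "\<epsilon>0 > 0"
    and "\<And>\<epsilon>::real. 0 < \<epsilon> \<Longrightarrow> \<epsilon> \<le> \<epsilon>0 \<Longrightarrow> modulus T (ennreal \<epsilon>) F1 \<le> modulus T (ennreal \<epsilon>) F2"
    and "\<And>n. n \<ge> 1 \<Longrightarrow> That n \<in> borel_measurable path_space"
    and "cs > 0"
    and "\<And>n. n \<ge> 1 \<Longrightarrow>
           (SUP f\<in>F1. mse M W n T (That n) f) \<le> ennreal (cs\<^sup>2) * (modulus T (noise_level n) F1)\<^sup>2"
  shows "\<exists>c::real. c > 0 \<and>
    (\<forall>\<^sub>F n in sequentially.
       (SUP f\<in>F2. mse M W n T (That n) f) \<ge>
         ennreal c * ((between_modulus T (log_radius (gamma_n T F1 F2 cs n) n) F1 F2)\<^sup>2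
                      + (modulus T (noise_level n) F2)\<^sup>2))"
proof -
  have F: "F1 \<subseteq> L2_functions" "F2 \<subseteq> L2_functions"
    using assms(2-4) by (auto simp: linear_functional_on_def)
  \<comment> \<open>\<open>C * s\<close> dominates \<open>max (12 * s) (3 * (cs * v))\<close> for
    \<open>v \<le> 12 * s\<close>. The two moduli then contribute \<open>C\<^sup>2\<close> and 144,
    the square of 12, and \<open>c\<close> is the reciprocal of their sum.\<close>
  define C where "C = 12 + 36 * cs"
  define c where "c = 1 / (C\<^sup>2 + 144)"
  have "C > 0" using \<open>cs > 0\<close> by (simp add: C_def)
  have "C\<^sup>2 + 144 > 0" by (simp add: add_nonneg_pos)
  then have "c > 0" and c: "c * (C\<^sup>2 + 144) = 1" by (simp_all add: c_def)
  \<comment> \<open>The moduli of the two classes are comparable only at radii up to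
    \<open>\<epsilon>0\<close>, which the noise level eventually satisfies.\<close>
  have "(\<lambda>n. 1 / sqrt (real n)) \<longlonglongrightarrow> 0" by real_asymp
  then have "\<forall>\<^sub>F n in sequentially. 1 / sqrt (real n) < \<epsilon>0"
    using \<open>\<epsilon>0 > 0\<close> by (rule order_tendstoD)
  with eventually_ge_at_top[of 1] have "\<forall>\<^sub>F n in sequentially.
       (SUP f\<in>F2. mse M W n T (That n) f) \<ge>
         ennreal c * ((between_modulus T (log_radius (gamma_n T F1 F2 cs n) n) F1 F2)\<^sup>2
                      + (modulus T (noise_level n) F2)\<^sup>2)"
  proof eventually_elim
    case (elim n)
    let ?R = "SUP f\<in>F2. mse M W n T (That n) f"
    let ?B = "between_modulus T (log_radius (gamma_n T F1 F2 cs n) n) F1 F2"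
    let ?w1 = "modulus T (noise_level n) F1" and ?w2 = "modulus T (noise_level n) F2"
    show ?case
    proof (cases "?R = \<top>")
      case False
      \<comment> \<open>An infinite maximal risk settles the claim at once; a finite one is written
        as a square, the form used by the risk bounds.\<close>
      define s where "s = sqrt (enn2real ?R)"
      have "?R < \<top>" using False by (simp only: less_top)
      then have "ennreal (enn2real ?R) = ?R" by (rule ennreal_enn2real)
      then have s: "s \<ge> 0" "?R = ennreal (s\<^sup>2)"
        unfolding s_def by (simp_all only: real_sqrt_pow2 enn2real_nonneg real_sqrt_ge_zero)
      have risk2: "mse M W n T (That n) g \<le> ennreal (s\<^sup>2)" if "g \<in> F2" for g
        unfolding s(2)[symmetric] using that by (rule SUP_upper)
      have w2: "?w2 \<le> ennreal (12 * s)"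
        by (rule modulus_noise_level_le[OF assms(1) F(2) _ assms(8) risk2 s(1)]) (use elim in auto)
      moreover have "?w1 \<le> ?w2"
        unfolding noise_level_def using elim by (intro assms(7)) auto
      ultimately have "?w1 \<le> ennreal (12 * s)" by (rule order_trans[rotated])
      then obtain v where v: "?w1 = ennreal v" "v \<ge> 0" "v \<le> 12 * s"
        by (cases ?w1) (use s(1) in \<open>auto simp: top_unique\<close>)
      have risk1: "mse M W n T (That n) f \<le> ennreal ((cs * v)\<^sup>2)" if "f \<in> F1" for f
      proof -
        have "mse M W n T (That n) f \<le> (SUP f\<in>F1. mse M W n T (That n) f)"
          using that by (rule SUP_upper)
        also have "\<dots> \<le> ennreal (cs\<^sup>2) * ?w1\<^sup>2" using elim by (intro assms(10))
        finally show ?thesis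
          using v \<open>cs > 0\<close> by (simp add: ennreal_power ennreal_mult[symmetric] power_mult_distrib)
      qed
      have "?B \<le> ennreal (max (12 * s) (3 * (cs * v)))"
        by (rule between_modulus_log_radius_le[OF assms(1) F _ assms(8) \<open>cs > 0\<close> v(2,1) risk1 risk2 s(1)])
           (use elim in auto)
      also have "max (12 * s) (3 * (cs * v)) \<le> C * s"
      proof -
        have "cs * v \<le> cs * (12 * s)" using v \<open>cs > 0\<close> by simp
        moreover have "cs * s \<ge> 0" using \<open>cs > 0\<close> s by simp
        ultimately show ?thesis using s unfolding C_def by (simp add: algebra_simps)
      qed
      finally have "?B \<le> ennreal (C * s)" by (simp add: ennreal_leI)
      then have "ennreal c * (?B\<^sup>2 + ?w2\<^sup>2) \<le> ennreal c * ((ennreal (C * s))\<^sup>2 + (ennreal (12 * s))\<^sup>2)"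
        using w2 by (intro mult_left_mono add_mono power_mono) auto
      also have "\<dots> = ennreal (c * (C\<^sup>2 + 144) * s\<^sup>2)"
        using s \<open>c > 0\<close> \<open>C > 0\<close>
        by (simp add: ennreal_power ennreal_mult[symmetric] ennreal_plus[symmetric] power_mult_distrib algebra_simps del: ennreal_plus)
      also have "\<dots> = ?R" by (simp add: c s(2))
      finally show ?thesis .
    qed (simp only: top_greatest)
  qed
  with \<open>c > 0\<close> show ?thesis by blast
qed

end
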